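(* Let $K$ be an arbitrary field and $p\in K\langle x_1,\dots,x_m\rangle$ a multilinear polynomial evaluated on $M_2(K)$. Then $\operatorname{Im} p$ is either $\{0\}$, or the set $K$ of scalar matrices, or $\operatorname{sl}_2(K)\subseteq \operatorname{Im} p$. If $K=\mathbb{R}$, then $\operatorname{Im} p$ is exactly one of $\{0\}$, $\mathbb{R}$ (scalar matrices), $\operatorname{sl}_2(\mathbb{R})$, or $M_2(\mathbb{R})$.
   Context: A polynomial is multilinear if it has the form $\sum_{\sigma\in S_m}c_\sigma x_{\sigma(1)}\cdots x_{\sigma(m)}$. $\operatorname{Im} p=\{p(a_1,\dots,a_m):a_i\in M_2(K)\}$, and $\operatorname{sl}_2(K)$ is the set of trace-zero $2\times2$ matrices. *)

theory Defs
  imports "HOL-Analysis.Analysis" "HOL-Library.Numeral_Type"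
begin

text \<open>2x2 matrices over a field K are the type 'a^2^2 (HOL-Analysis).
  Ordered (noncommutative) product of a list of matrices.\<close>
definition mprod :: "('a::comm_ring_1^2^2) list \<Rightarrow> 'a^2^2" where
  "mprod xs = foldr (**) xs (mat 1)"

text \<open>A multilinear polynomial p = sum over sigma in S_m of c_sigma x_{sigma(1)} ... x_{sigma(m)},
  with variables indexed 0..m-1, is given by its coefficient function c on permutations
  of {..<m}. Its evaluation at the matrices a 0, ..., a (m-1):\<close>
definition mlin_eval :: "nat \<Rightarrow> ((nat \<Rightarrow> nat) \<Rightarrow> 'a::field) \<Rightarrow> (nat \<Rightarrow> 'a^2^2) \<Rightarrow> 'a^2^2" where
  "mlin_eval m c a = (\<Sum>\<sigma>\<in>{\<sigma>. \<sigma> permutes {..<m}}. mat (c \<sigma>) ** mprod (map (\<lambda>i. a (\<sigma> i)) [0..<m]))"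

text \<open>Image of p on M_2(K).\<close>
definition mlin_image :: "nat \<Rightarrow> ((nat \<Rightarrow> nat) \<Rightarrow> 'a::field) \<Rightarrow> ('a^2^2) set" where
  "mlin_image m c = {mlin_eval m c a | a. True}"

text \<open>Scalar matrices and sl_2(K).\<close>
definition scalar_mats :: "('a::field^2^2) set" where
  "scalar_mats = range mat"

definition sl2 :: "('a::field^2^2) set" where
  "sl2 = {A. trace A = 0}"

end

theory Submission
  imports Defs
begin

text \<open>
  Give e12 degree 1, e21 degree -1 and diagonal matrices degree 0. By multilinearity, a linear
  functional that does not vanish on the image is nonzero at some tuple of homogeneous matrices,
  and the value there is homogeneous as well. If all values are diagonal, conjugation invariance
  makes them scalar. Otherwise some homogeneous tuple has a nonzero multiple of e12 as value, and
  conjugating by the transposition matrix gives the same multiple of e21. A multilinear map with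
  two linearly independent values takes all values in some plane, which here is the plane of
  off-diagonal matrices because mixing the two tuples preserves the parity of the degree. Every
  nonscalar matrix of trace 0 is similar to an off-diagonal one. In characteristic 2 the scalar
  matrices are obtained in the same way from tuples of degree 0.

  Over the reals, suppose that the trace does not vanish on the image. A nonscalar matrix of nonzero
  trace is determined up to similarity and scaling by disc / trace^2. This ratio tends to both
  infinities near tuples whose value has trace 0, and takes all intermediate values along a
  generic polygon of tuples on which the trace does not vanish.
\<close>

section \<open>Entries of 2x2 matrices\<close>

lemma mat2_eq_iff:
  fixes A B :: "'a^2^2"
  shows "A = B \<longleftrightarrow> A$1$1 = B$1$1 \<and> A$1$2 = B$1$2 \<and> A$2$1 = B$2$1 \<and> A$2$2 = B$2$2"
  by (auto simp: vec_eq_iff forall_2)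

lemma mult_nth2:
  fixes A B :: "'a::semiring_1^2^2"
  shows "(A ** B)$i$j = A$i$1 * B$1$j + A$i$2 * B$2$j"
  by (simp add: matrix_matrix_mult_def sum_2)

lemma mat_nth: "(mat s :: 'a::zero^'n^'n)$i$j = (if i = j then s else 0)"
  by (simp add: mat_def)

lemma scale_nth: "(mat s ** A)$i$j = s * (A :: 'a::field^2^2)$i$j"
  using exhaust_2[of i] by (auto simp: mult_nth2 mat_nth)

lemma trace_2: "trace (A :: 'a::field^2^2) = A$1$1 + A$2$2"
  by (simp add: trace_def sum_2)

definition mat2 :: "'a::zero \<Rightarrow> 'a \<Rightarrow> 'a \<Rightarrow> 'a \<Rightarrow> 'a^2^2" where
  "mat2 a b c d = vector [vector [a, b], vector [c, d]]"

lemma mat2_nth [simp]: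
  "mat2 a b c d $ 1 $ 1 = a" "mat2 a b c d $ 1 $ 2 = b"
  "mat2 a b c d $ 2 $ 1 = c" "mat2 a b c d $ 2 $ 2 = d"
  by (simp_all add: mat2_def)

lemmas mat2_simps = mat2_eq_iff mult_nth2 mat_nth trace_2

subsection \<open>Multilinearity and conjugation\<close>

lemma mprod_Nil [simp]: "mprod [] = mat 1"
  and mprod_Cons [simp]: "mprod (A # xs) = A ** mprod xs"
  by (simp_all add: mprod_def)

lemma mprod_append: "mprod (xs @ ys) = mprod xs ** mprod ys"
  by (induction xs) (simp_all add: matrix_mul_assoc)

lemma mprod_conjugate:
  assumes "h ** g = mat 1" "g ** h = mat 1"
  shows "mprod (map (\<lambda>A. g ** A ** h) xs) = g ** mprod xs ** h"
proof (induction xs)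
  case Nil
  then show ?case using assms by simp
next
  case (Cons A xs)
  have "g ** A ** h ** (g ** mprod xs ** h) = g ** A ** (h ** g) ** mprod xs ** h"
    by (simp add: matrix_mul_assoc)
  with Cons show ?case using assms by (simp add: matrix_mul_assoc)
qed

lemma mat_commute:
  fixes A :: "'a::field^2^2"
  shows "mat s ** A = A ** mat s"
  by (simp add: mat2_simps)

lemma mlin_eval_conjugate:
  assumes "h ** g = mat 1" "g ** h = mat 1"
  shows "mlin_eval m c (\<lambda>i. g ** a i ** h) = g ** mlin_eval m c a ** h"
proof -
  let ?f = "\<lambda>M. g ** M ** h"
  have "mlin_eval m c (\<lambda>i. g ** a i ** h) =
      sum (?f \<circ> (\<lambda>\<sigma>. mat (c \<sigma>) ** mprod (map (\<lambda>i. a (\<sigma> i)) [0..<m]))) {\<sigma>. \<sigma> permutes {..<m}}"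
    unfolding mlin_eval_def
  proof (rule sum.cong[OF refl])
    fix \<sigma>
    show "mat (c \<sigma>) ** mprod (map (\<lambda>i. g ** a (\<sigma> i) ** h) [0..<m]) =
        (?f \<circ> (\<lambda>\<sigma>. mat (c \<sigma>) ** mprod (map (\<lambda>i. a (\<sigma> i)) [0..<m]))) \<sigma>"
      using mprod_conjugate[OF assms, of "map (\<lambda>i. a (\<sigma> i)) [0..<m]"]
      by (simp add: o_def matrix_mul_assoc mat_commute[of _ g])
  qed
  also have "\<dots> = ?f (mlin_eval m c a)"
    unfolding mlin_eval_def
    by (rule sum_comp_morphism) (simp_all add: mat2_simps algebra_simps)
  finally show ?thesis .
qed

text \<open>As \<open>\<sigma>\<close> is a bijection, variable \<open>k\<close> occurs in exactly
  one factor, and the product is \<open>X ** (C ** Y)\<close> with \<open>X\<close>,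
  \<open>Y\<close> independent of the matrix \<open>C\<close> put there.\<close>

lemma mprod_linear:
  assumes \<sigma>: "\<sigma> permutes {..<m}" and k: "k < m"
  shows "mprod (map (\<lambda>i. (a(k := mat s ** A + mat t ** B)) (\<sigma> i)) [0..<m]) =
    mat s ** mprod (map (\<lambda>i. (a(k := A)) (\<sigma> i)) [0..<m]) +
    mat (t :: 'a::field) ** mprod (map (\<lambda>i. (a(k := B)) (\<sigma> i)) [0..<m])"
proof -
  obtain j where j: "j < m" "\<sigma> j = k"
    using permutes_image[OF \<sigma>] k by (metis imageE lessThan_iff)
  have upt: "[0..<m] = [0..<j] @ j # [Suc j..<m]"
    using upt_add_eq_append[of 0 j "m - j"] j by (simp add: upt_conv_Cons)
  have ne: "\<sigma> i \<noteq> k" if "i \<noteq> j" for i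
    using j that permutes_inj[OF \<sigma>] by (metis injD)
  define X Y where "X = mprod (map (\<lambda>i. a (\<sigma> i)) [0..<j])"
    and "Y = mprod (map (\<lambda>i. a (\<sigma> i)) [Suc j..<m])"
  have "mprod (map (\<lambda>i. (a(k := C)) (\<sigma> i)) [0..<m]) = X ** (C ** Y)" for C
  proof -
    have eqs: "map (\<lambda>i. (a(k := C)) (\<sigma> i)) [0..<j] = map (\<lambda>i. a (\<sigma> i)) [0..<j]"
      "map (\<lambda>i. (a(k := C)) (\<sigma> i)) [Suc j..<m] = map (\<lambda>i. a (\<sigma> i)) [Suc j..<m]"
      using ne by auto
    show ?thesis
      unfolding upt map_append list.map mprod_append mprod_Cons eqs X_def Y_def using j by simp
  qed
  then show ?thesis
    by (simp add: mat2_simps scale_nth algebra_simps)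
qed

lemma mlin_eval_linear:
  assumes "k < m"
  shows "mlin_eval m c (a(k := mat s ** A + mat t ** B)) =
    mat s ** mlin_eval m c (a(k := A)) + mat t ** mlin_eval m c (a(k := B))"
proof -
  define T where "T = (\<lambda>C \<sigma>. mat (c \<sigma>) ** mprod (map (\<lambda>i. (a(k := C)) (\<sigma> i)) [0..<m]))"
  have scale: "mat s ** sum f S = (\<Sum>\<sigma>\<in>S. mat s ** f \<sigma>)" for s and f :: "_ \<Rightarrow> 'a^2^2" and S
    using sum_comp_morphism[of "\<lambda>M. mat s ** M" f S]
    by (simp add: o_def matrix_add_ldistrib mat2_simps)
  have "T (mat s ** A + mat t ** B) \<sigma> = mat s ** T A \<sigma> + mat t ** T B \<sigma>"
    if "\<sigma> permutes {..<m}" for \<sigma>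
    unfolding T_def mprod_linear[OF that assms]
    by (simp add: mat2_eq_iff scale_nth algebra_simps)
  then show ?thesis
    unfolding mlin_eval_def scale sum.distrib[symmetric] T_def by (intro sum.cong refl) simp
qed

lemma mlin_eval_cong: "(\<And>i. i < m \<Longrightarrow> a i = b i) \<Longrightarrow> mlin_eval m c a = mlin_eval m c b"
proof -
  assume "\<And>i. i < m \<Longrightarrow> a i = b i"
  then have "map (\<lambda>i. a (\<sigma> i)) [0..<m] = map (\<lambda>i. b (\<sigma> i)) [0..<m]" if "\<sigma> permutes {..<m}" for \<sigma>
    using permutes_in_image[OF that] by auto
  then show ?thesis unfolding mlin_eval_def by (intro sum.cong refl) (metis mem_Collect_eq)
qed

lemma mlin_eval_add:
  assumes "k < m"
  shows "mlin_eval m c (a(k := A + B)) = mlin_eval m c (a(k := A)) + mlin_eval m c (a(k := B))"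
  using mlin_eval_linear[OF assms, of c a 1 A 1 B] by simp

lemma mlin_image_scale:
  assumes "M \<in> mlin_image m c" "m \<ge> 1"
  shows "mat s ** M \<in> mlin_image m c"
proof -
  obtain a where a: "M = mlin_eval m c a" using assms by (auto simp: mlin_image_def)
  \<comment> \<open>\<open>m \<ge> 1\<close> provides a variable to absorb the scalar; the zero
    summand gives the shape of \<open>mlin_eval_linear\<close>.\<close>
  have "mlin_eval m c (a(0 := mat s ** a 0 + mat 0 ** a 0)) = mat s ** M"
    using assms(2) by (subst mlin_eval_linear) (auto simp: a mat2_eq_iff scale_nth)
  then show ?thesis unfolding mlin_image_def by (metis (mono_tags, lifting) mem_Collect_eq)
qed

lemma mlin_image_conjugate:
  assumes "M \<in> mlin_image m c" "h ** g = mat 1" "g ** h = mat 1"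
  shows "g ** M ** h \<in> mlin_image m c"
  using assms(1) mlin_eval_conjugate[OF assms(2,3), of m c]
  unfolding mlin_image_def by (auto simp: eq_sym_conv)

text \<open>Conjugation by the permutation matrix \<open>mat2 0 1 1 0\<close>, which interchanges
  e12 and e21.\<close>

definition flip :: "'a::field^2^2 \<Rightarrow> 'a^2^2" where
  "flip A = mat2 (A$2$2) (A$2$1) (A$1$2) (A$1$1)"

lemma flip_nth [simp]:
  "flip A $ 1 $ 1 = A$2$2" "flip A $ 1 $ 2 = A$2$1" "flip A $ 2 $ 1 = A$1$2" "flip A $ 2 $ 2 = A$1$1"
  by (simp_all add: flip_def)

lemma mlin_eval_flip: "mlin_eval m c (\<lambda>i. flip (a i)) = flip (mlin_eval m c a)"
proof -
  have "flip A = mat2 0 1 1 0 ** A ** mat2 0 1 1 0" for A :: "'a^2^2"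
    by (simp add: mat2_simps)
  moreover have "mat2 0 1 1 0 ** mat2 0 1 1 0 = (mat 1 :: 'a^2^2)"
    by (simp add: mat2_simps)
  ultimately show ?thesis
    using mlin_eval_conjugate[of "mat2 0 1 1 0" "mat2 0 1 1 0" m c a] by simp
qed

text \<open>A nonscalar 2x2 matrix has a cyclic vector, so it is similar to the companion matrix of
  its characteristic polynomial, with second column (-det, trace).\<close>

lemma nonscalar_similar_companion:
  fixes A :: "'a::field^2^2"
  assumes "A \<notin> scalar_mats"
  obtains g h where "h ** g = mat 1" "g ** h = mat 1"
    "A = g ** mat2 0 (A$1$2 * A$2$1 - A$1$1 * A$2$2) 1 (A$1$1 + A$2$2) ** h"
proof -
  let ?C = "mat2 0 (A$1$2 * A$2$1 - A$1$1 * A$2$2) 1 (A$1$1 + A$2$2)"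
  note result = that
  \<comment> \<open>The columns of g are a vector (u, v) that is not an eigenvector of A and its image under A.\<close>
  have *: thesis if D: "D = u * (A$2$1 * u + A$2$2 * v) - v * (A$1$1 * u + A$1$2 * v)" "D \<noteq> 0" for u v D
  proof (rule result)
    define g where "g = mat2 u (A$1$1 * u + A$1$2 * v) v (A$2$1 * u + A$2$2 * v)"
    \<comment> \<open>\<open>h'\<close> is the adjugate of \<open>g\<close>, and \<open>D\<close> is
      the determinant of \<open>g\<close>.\<close>
    define h' where "h' = mat2 (A$2$1 * u + A$2$2 * v) (- (A$1$1 * u + A$1$2 * v)) (- v) u"
    define h where "h = mat (1 / D) ** h'"
    have hg': "h' ** g = mat D" "g ** h' = mat D"
      unfolding h'_def g_def D(1) by (simp_all add: mat2_simps algebra_simps)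
    have "mat (1 / D) ** mat D = (mat 1 :: 'a^2^2)" using D(2) by (simp add: mat2_simps)
    then show hg: "h ** g = mat 1" and gh: "g ** h = mat 1"
      unfolding h_def using hg' mat_commute[of "1 / D" g]
      by (metis matrix_mul_assoc)+
    \<comment> \<open>The second columns agree by Cayley-Hamilton.\<close>
    have "A ** g = g ** ?C"
      unfolding g_def by (simp add: mat2_simps algebra_simps)
    then show "A = g ** ?C ** h"
      by (metis gh matrix_mul_assoc matrix_mul_rid)
  qed
  have "A$2$1 \<noteq> 0 \<or> A$1$2 \<noteq> 0 \<or> A$1$1 \<noteq> A$2$2"
  proof (rule ccontr)
    assume "\<not> ?thesis"
    then have "A = mat (A$1$1)" by (simp add: mat2_simps)
    with assms show False by (auto simp: scalar_mats_def)
  qed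
  \<comment> \<open>In these cases e1, e2 and e1 + e2, respectively, is not an eigenvector.\<close>
  then consider "A$2$1 \<noteq> 0" | "A$1$2 \<noteq> 0" | "A$2$1 = 0" "A$1$2 = 0" "A$1$1 \<noteq> A$2$2" by blast
  then show thesis
  proof cases
    case 1 then show thesis by (intro *[OF refl, of 1 0]) auto
  next
    case 2 then show thesis by (intro *[OF refl, of 0 1]) auto
  next
    case 3 then show thesis by (intro *[OF refl, of 1 1]) auto
  qed
qed

text \<open>The image is closed under similarity, so membership of a nonscalar matrix depends only
  on its trace and determinant.\<close>

lemma nonscalar_mem_mlin_image_iff:
  assumes "A \<notin> scalar_mats"
  shows "A \<in> mlin_image m c \<longleftrightarrow>
    mat2 0 (A$1$2 * A$2$1 - A$1$1 * A$2$2) 1 (A$1$1 + A$2$2) \<in> mlin_image m c"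
proof -
  let ?C = "mat2 0 (A$1$2 * A$2$1 - A$1$1 * A$2$2) 1 (A$1$1 + A$2$2)"
  obtain g h where gh: "h ** g = mat 1" "g ** h = mat 1" "A = g ** ?C ** h"
    using nonscalar_similar_companion[OF assms] .
  have "h ** (g ** ?C ** h) ** g = (h ** g) ** ?C ** (h ** g)"
    by (simp only: matrix_mul_assoc)
  then have "?C = h ** A ** g" using gh by simp
  then show ?thesis
    using mlin_image_conjugate gh by metis
qed

subsection \<open>A multilinear map with two independent values attains a plane of values\<close>

locale linear_functional =
  fixes \<phi> :: "'a::field^2^2 \<Rightarrow> 'a"
  assumes add: "\<phi> (A + B) = \<phi> A + \<phi> B" and scale: "\<phi> (mat s ** A) = s * \<phi> A"

lemma linear_functional_nth: "linear_functional (\<lambda>A. A$i$j)"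
  by unfold_locales (simp_all add: scale_nth)

lemma linear_functional_trace: "linear_functional (trace :: 'a::field^2^2 \<Rightarrow> 'a)"
  by unfold_locales (simp_all add: trace_2 scale_nth algebra_simps)

text \<open>The functionals are coordinates on the target plane; \<open>S i\<close> confines the
  i-th argument. By induction on the number of positions where \<open>x\<close> and \<open>y\<close>
  differ: either two independent values come from tuples differing in one position, where linearity
  in that argument suffices, or there is an independent pair with fewer differences.\<close>

lemma mlin_eval_plane:
  fixes S :: "nat \<Rightarrow> ('a::field^2^2) set"
  assumes "linear_functional \<phi>" "linear_functional \<psi>"
    and S: "\<And>i A B s t. A \<in> S i \<Longrightarrow> B \<in> S i \<Longrightarrow> mat s ** A + mat t ** B \<in> S i"
    and "\<And>i. x i \<in> S i" "\<And>i. y i \<in> S i"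
    and "\<phi> (mlin_eval m c x) * \<psi> (mlin_eval m c y) \<noteq> \<phi> (mlin_eval m c y) * \<psi> (mlin_eval m c x)"
  shows "\<exists>z. (\<forall>i. z i \<in> S i) \<and> \<phi> (mlin_eval m c z) = \<alpha> \<and> \<psi> (mlin_eval m c z) = \<beta>"
  using assms(4-6)
proof (induction "card {i. i < m \<and> x i \<noteq> y i}" arbitrary: x y rule: less_induct)
  case less
  interpret \<phi>: linear_functional \<phi> by fact
  interpret \<psi>: linear_functional \<psi> by fact
  let ?P = "mlin_eval m c"
  let ?ind = "\<lambda>u v. \<phi> (?P u) * \<psi> (?P v) \<noteq> \<phi> (?P v) * \<psi> (?P u)"
  note S_mem = less.prems(1,2)
  have "\<exists>i<m. x i \<noteq> y i"
  proof (rule ccontr)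
    assume "\<not> ?thesis"
    then have "?P x = ?P y" by (intro mlin_eval_cong) auto
    with less.prems show False by simp
  qed
  then obtain i where i: "i < m" "x i \<noteq> y i" by blast
  have fewer: "\<exists>z. (\<forall>i. z i \<in> S i) \<and> \<phi> (?P z) = \<alpha> \<and> \<psi> (?P z) = \<beta>"
    if "\<And>j. u j \<in> S j" "\<And>j. v j \<in> S j" "?ind u v" "u i = v i"
      "\<And>j. j \<noteq> i \<Longrightarrow> u j = x j \<and> v j = y j" for u v
  proof (rule less.hyps)
    have "{j. j < m \<and> u j \<noteq> v j} \<subset> {j. j < m \<and> x j \<noteq> y j}"
    proof
      show "{j. j < m \<and> u j \<noteq> v j} \<subseteq> {j. j < m \<and> x j \<noteq> y j}"
      proof
        fix j
        assume "j \<in> {j. j < m \<and> u j \<noteq> v j}"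
        then show "j \<in> {j. j < m \<and> x j \<noteq> y j}"
          using that(4) that(5)[of j] by (cases "j = i") auto
      qed
      show "{j. j < m \<and> u j \<noteq> v j} \<noteq> {j. j < m \<and> x j \<noteq> y j}"
        using i that(4) by blast
    qed
    then show "card {j. j < m \<and> u j \<noteq> v j} < card {j. j < m \<and> x j \<noteq> y j}"
      by (intro psubset_card_mono) auto
  qed (use that in auto)
  have line: "\<exists>z. (\<forall>i. z i \<in> S i) \<and> \<phi> (?P z) = \<alpha> \<and> \<psi> (?P z) = \<beta>"
    if "\<And>j. u j \<in> S j" "B \<in> S i" "?ind u (u(i := B))" for u B
  proof -
    define p q r s where defs: "p = \<phi> (?P u)" "q = \<psi> (?P u)"
      "r = \<phi> (?P (u(i := B)))" "s = \<psi> (?P (u(i := B)))"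
    define D where "D = p * s - r * q"
    have "D \<noteq> 0" using that(3) by (simp add: D_def defs)
    \<comment> \<open>Cramer's rule for expressing \<open>(\<alpha>, \<beta>)\<close> through the
      two independent values.\<close>
    define a b where "a = (\<alpha> * s - \<beta> * r) / D" and "b = (\<beta> * p - \<alpha> * q) / D"
    define z where "z = u(i := mat a ** u i + mat b ** B)"
    have "?P z = mat a ** ?P u + mat b ** ?P (u(i := B))"
      unfolding z_def by (subst mlin_eval_linear[OF i(1)]) simp
    then have "\<phi> (?P z) = a * p + b * r" "\<psi> (?P z) = a * q + b * s"
      by (simp_all add: \<phi>.add \<phi>.scale \<psi>.add \<psi>.scale defs)
    moreover have "a * D = \<alpha> * s - \<beta> * r" "b * D = \<beta> * p - \<alpha> * q"
      using \<open>D \<noteq> 0\<close> by (simp_all add: a_def b_def)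
    then have "(a * p + b * r) * D = \<alpha> * D" "(a * q + b * s) * D = \<beta> * D"
      unfolding D_def by algebra+
    moreover have "z j \<in> S j" for j
      using that S by (auto simp: z_def)
    ultimately show ?thesis using \<open>D \<noteq> 0\<close> by auto
  qed
  define A where "A = x(i := y i)"
  define B where "B = y(i := x i)"
  have AS: "A j \<in> S j" "B j \<in> S j" for j using S_mem by (auto simp: A_def B_def)
  consider "?ind x A" | "?ind y B" | "?ind A y" | "?ind x B"
    | "\<not> ?ind x A" "\<not> ?ind y B" "\<not> ?ind A y" "\<not> ?ind x B" by blast
  then show ?case
  proof cases
    case 1 then show ?thesis using line[of x "y i"] S_mem by (auto simp: A_def)
  next
    case 2 then show ?thesis using line[of y "x i"] S_mem by (auto simp: B_def)
  next
    case 3 then show ?thesis by (intro fewer[of A y]) (use AS S_mem in \<open>auto simp: A_def\<close>)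
  next
    case 4 then show ?thesis by (intro fewer[of x B]) (use AS S_mem in \<open>auto simp: B_def\<close>)
  next
    case 5
    \<comment> \<open>A value dependent on both of two independent ones vanishes, so the i-th coordinate
      of x and of y can be replaced by the sum x i + y i.\<close>
    have zero: "u = 0 \<and> v = 0"
      if "p * s \<noteq> r * q" "p * v = u * q" "u * s = r * v" for p q r s u v :: 'a
    proof -
      have "u * (p * s - r * q) = 0" "v * (p * s - r * q) = 0" using that by algebra+
      then show ?thesis using that(1) by simp
    qed
    have A0: "\<phi> (?P A) = 0 \<and> \<psi> (?P A) = 0"
      using zero[OF less.prems(3)] 5(1,3) by blast
    have B0: "\<phi> (?P B) = 0 \<and> \<psi> (?P B) = 0"
      using zero[OF less.prems(3), of "\<psi> (?P B)" "\<phi> (?P B)"] 5(2,4) by (metis mult.commute)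
    define u where "u = x(i := x i + y i)"
    define v where "v = y(i := x i + y i)"
    have uv: "?P u = ?P x + ?P A" "?P v = ?P B + ?P y"
      using mlin_eval_add[OF i(1), of c x "x i" "y i"] mlin_eval_add[OF i(1), of c y "x i" "y i"]
      by (simp_all add: u_def v_def A_def B_def)
    have ind: "?ind u v"
      unfolding uv \<phi>.add \<psi>.add using less.prems(3) A0 B0 by simp
    have sum: "x i + y i \<in> S i" using S[OF S_mem(1)[of i] S_mem(2)[of i], of 1 1] by simp
    show ?thesis
      by (rule fewer[of u v, OF _ _ ind]) (use S_mem sum in \<open>auto simp: u_def v_def\<close>)
  qed
qed

subsection \<open>Gradings of the matrix algebra\<close>

text \<open>Degree 0 for diagonal matrices, e and -e for the two off-diagonal matrix units; the integer
  grading (e = 1) and the parity grading (e = 1 in the two-element group) are both used.\<close>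

definition homogeneous :: "'g::ab_group_add \<Rightarrow> 'g \<Rightarrow> 'a::field^2^2 \<Rightarrow> bool" where
  "homogeneous e d A \<longleftrightarrow> (A$1$1 \<noteq> 0 \<longrightarrow> d = 0) \<and> (A$2$2 \<noteq> 0 \<longrightarrow> d = 0) \<and>
    (A$1$2 \<noteq> 0 \<longrightarrow> d = e) \<and> (A$2$1 \<noteq> 0 \<longrightarrow> d = - e)"

lemma homogeneous_lincomb:
  "homogeneous e d A \<Longrightarrow> homogeneous e d B \<Longrightarrow> homogeneous e d (mat s ** A + mat t ** B)"
  unfolding homogeneous_def by (auto simp: scale_nth)

lemma homogeneous_mult:
  assumes "homogeneous e d A" "homogeneous e d' B"
  shows "homogeneous e (d + d') (A ** B)"
proof -
  have "A$i$1 * B$1$j \<noteq> 0 \<or> A$i$2 * B$2$j \<noteq> 0" if "(A ** B)$i$j \<noteq> 0" for i j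
    using that by (auto simp: mult_nth2)
  then show ?thesis
    using assms unfolding homogeneous_def by (metis add_0 add_0_right mult_zero_left mult_zero_right
      add.right_inverse add.left_inverse)
qed

lemma homogeneous_mprod:
  "(\<And>i. i \<in> set is \<Longrightarrow> homogeneous e (d i) (a i)) \<Longrightarrow> homogeneous e (\<Sum>i\<leftarrow>is. d i) (mprod (map a is))"
proof (induction "is")
  case Nil
  show ?case by (simp add: homogeneous_def mat_nth)
next
  case (Cons i "is")
  then show ?case by (simp add: homogeneous_mult)
qed

text \<open>Every monomial contains each variable exactly once, so all monomials have the same total
  degree.\<close>

lemma homogeneous_mlin_eval:
  fixes a :: "nat \<Rightarrow> 'a::field^2^2"
  assumes "\<And>i. i < m \<Longrightarrow> homogeneous e (d i) (a i)"
  shows "homogeneous e (\<Sum>i<m. d i) (mlin_eval m c a)"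
proof -
  have terms: "homogeneous e (\<Sum>i<m. d i) (mat (c \<sigma>) ** mprod (map (\<lambda>i. a (\<sigma> i)) [0..<m]))"
    if "\<sigma> permutes {..<m}" for \<sigma>
  proof -
    have "homogeneous e (\<Sum>i\<leftarrow>[0..<m]. d (\<sigma> i)) (mprod (map (\<lambda>i. a (\<sigma> i)) [0..<m]))"
      using permutes_in_image[OF that] by (intro homogeneous_mprod assms) auto
    moreover have "(\<Sum>i\<leftarrow>[0..<m]. d (\<sigma> i)) = (\<Sum>i<m. d (\<sigma> i))"
      by (simp add: sum_list_distinct_conv_sum_set atLeast0LessThan)
    moreover have "\<dots> = (\<Sum>i<m. d i)"
      using sum.permute[OF that, of d] by (simp add: o_def)
    ultimately have "homogeneous e (\<Sum>i<m. d i) (mprod (map (\<lambda>i. a (\<sigma> i)) [0..<m]))" by simp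
    then show ?thesis by (simp add: homogeneous_def scale_nth)
  qed
  have sums: "homogeneous e d (sum f S)"
    if "\<And>\<sigma>. \<sigma> \<in> S \<Longrightarrow> homogeneous e d (f \<sigma>)" for S d and f :: "(nat \<Rightarrow> nat) \<Rightarrow> 'a^2^2"
    using that
  proof (induction S rule: infinite_finite_induct)
    case (insert s S)
    then show ?case using homogeneous_lincomb[of e d "f s" "sum f S" 1 1] by simp
  qed (simp_all add: homogeneous_def)
  show ?thesis unfolding mlin_eval_def by (intro sums terms) simp
qed

text \<open>The arguments are replaced one by one by a component of degree 0, 1 or -1; by additivity
  \<open>\<phi>\<close> is nonzero for at least one of the three choices.\<close>

lemma homogeneous_tuple_exists:
  assumes "linear_functional \<phi>" "\<phi> (mlin_eval m c a) \<noteq> 0"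
  obtains d :: "nat \<Rightarrow> int" and x where
    "\<And>i. homogeneous 1 (d i) (x i)" "\<phi> (mlin_eval m c x) \<noteq> 0"
proof -
  interpret linear_functional \<phi> by fact
  have "\<exists>x. (\<forall>i<k. \<exists>d::int. homogeneous 1 d (x i)) \<and> \<phi> (mlin_eval m c x) \<noteq> 0" if "k \<le> m" for k
    using that
  proof (induction k)
    case 0
    then show ?case using assms by auto
  next
    case (Suc k)
    then obtain x where x: "\<And>i. i < k \<Longrightarrow> \<exists>d::int. homogeneous 1 d (x i)"
      "\<phi> (mlin_eval m c x) \<noteq> 0" by auto
    define A B C where "A = mat2 (x k $1$1) 0 0 (x k $2$2)" and "B = mat2 0 (x k $1$2) 0 0"
      and "C = mat2 0 0 (x k $2$1) 0"
    have "x = x(k := A + B + C)"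
      by (rule ext) (simp add: A_def B_def C_def mat2_eq_iff)
    then have "mlin_eval m c x =
        mlin_eval m c (x(k := A)) + mlin_eval m c (x(k := B)) + mlin_eval m c (x(k := C))"
      using Suc.prems by (metis mlin_eval_add Suc_le_lessD)
    with x(2) obtain D where D: "D \<in> {A, B, C}" "\<phi> (mlin_eval m c (x(k := D))) \<noteq> 0"
      unfolding add by (metis add.right_neutral insert_iff add)
    have "homogeneous (1::int) 0 A" "homogeneous (1::int) 1 B" "homogeneous (1::int) (-1) C"
      by (simp_all add: homogeneous_def A_def B_def C_def)
    with D(1) have "\<exists>d::int. homogeneous 1 d D" by blast
    with x(1) D(2) show ?case
      by (intro exI[of _ "x(k := D)"]) (auto simp: less_Suc_eq fun_upd_def)
  qed
  from this[of m] obtain x where x: "\<And>i. i < m \<Longrightarrow> \<exists>d::int. homogeneous 1 d (x i)"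
    "\<phi> (mlin_eval m c x) \<noteq> 0" by auto
  \<comment> \<open>Entries from index \<open>m\<close> on do not affect the value; zero is
    homogeneous of every degree, so \<open>d\<close> exists for all indices.\<close>
  define y where "y = (\<lambda>i. if i < m then x i else 0)"
  have "mlin_eval m c y = mlin_eval m c x" by (intro mlin_eval_cong) (simp add: y_def)
  moreover have "\<exists>d::int. homogeneous 1 d (y i)" for i
    using x(1) by (auto simp: y_def homogeneous_def)
  then obtain d :: "nat \<Rightarrow> int" where "\<And>i. homogeneous 1 (d i) (y i)" by metis
  ultimately show thesis using that x(2) by metis
qed

text \<open>In the two-element group 1 = -1, so e12 and e21 have the same degree and
  \<open>flip\<close> preserves parity.\<close>

lemma homogeneous_mod_2:
  assumes "homogeneous (1::int) d A"
  shows "homogeneous (1::2) (of_int d) A" "homogeneous (1::2) (of_int d) (flip A)"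
  using assms by (auto simp: homogeneous_def)

text \<open>The tuple \<open>x\<close> and its flip lie in the same parity components, so
  \<open>mlin_eval_plane\<close> applies inside these. The last assumption says that their two
  values are independent in the coordinates \<open>\<phi>\<close>, \<open>\<psi>\<close>.\<close>

lemma mlin_eval_parity_plane:
  fixes d :: "nat \<Rightarrow> int"
  assumes x: "\<And>i. homogeneous 1 (d i) (x i)"
    and "linear_functional \<phi>" "linear_functional \<psi>"
    and "\<phi> (mlin_eval m c x) * \<psi> (flip (mlin_eval m c x)) \<noteq>
      \<phi> (flip (mlin_eval m c x)) * \<psi> (mlin_eval m c x)"
  obtains z where "\<phi> (mlin_eval m c z) = \<alpha>" "\<psi> (mlin_eval m c z) = \<beta>"
    "homogeneous (1::2) (of_int (\<Sum>i<m. d i)) (mlin_eval m c z)"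
proof -
  define S where "S = (\<lambda>i. {A :: 'a^2^2. homogeneous (1::2) (of_int (d i)) A})"
  have "\<exists>z. (\<forall>i. z i \<in> S i) \<and> \<phi> (mlin_eval m c z) = \<alpha> \<and> \<psi> (mlin_eval m c z) = \<beta>"
  proof (rule mlin_eval_plane[OF assms(2,3), of S x "\<lambda>i. flip (x i)"])
    show "\<phi> (mlin_eval m c x) * \<psi> (mlin_eval m c (\<lambda>i. flip (x i))) \<noteq>
      \<phi> (mlin_eval m c (\<lambda>i. flip (x i))) * \<psi> (mlin_eval m c x)"
      using assms(4) by (simp add: mlin_eval_flip)
  qed (use homogeneous_mod_2[OF x] homogeneous_lincomb in \<open>auto simp: S_def\<close>)
  then obtain z where z: "\<And>i. homogeneous (1::2) (of_int (d i)) (z i)"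
    "\<phi> (mlin_eval m c z) = \<alpha>" "\<psi> (mlin_eval m c z) = \<beta>" by (auto simp: S_def)
  show thesis
    using that z homogeneous_mlin_eval[of m "1::2" "\<lambda>i. of_int (d i)" z c] by simp
qed

subsection \<open>Arbitrary fields\<close>

text \<open>A nonzero diagonal entry forces degree 0, so the value is diag(p, q). If p = q, scaling
  suffices; otherwise it is independent of its flip diag(q, p). Assumption \<open>pq\<close>
  excludes only q = -p \<noteq> p.\<close>

lemma scalar_mem_mlin_image:
  fixes d :: "nat \<Rightarrow> int" and c :: "(nat \<Rightarrow> nat) \<Rightarrow> 'a::field"
  assumes x: "\<And>i. homogeneous 1 (d i) (x i)" and "m \<ge> 1"
    and p: "p = mlin_eval m c x $1$1" and q: "q = mlin_eval m c x $2$2"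
    and ne: "p \<noteq> 0 \<or> q \<noteq> 0" and pq: "p = q \<or> p * p \<noteq> q * q"
  shows "mat s \<in> mlin_image m c"
proof -
  let ?M = "mlin_eval m c x"
  have hom: "homogeneous 1 (\<Sum>i<m. d i) ?M" by (intro homogeneous_mlin_eval x)
  with ne p q have deg: "(\<Sum>i<m. d i) = 0" by (auto simp: homogeneous_def)
  with hom have off: "?M$1$2 = 0" "?M$2$1 = 0" by (auto simp: homogeneous_def)
  show ?thesis
  proof (cases "p = q")
    case True
    then have "mat s = mat (s / p) ** ?M"
      using off p q ne by (simp add: mat2_eq_iff scale_nth mat_nth)
    moreover have "?M \<in> mlin_image m c" by (auto simp: mlin_image_def)
    ultimately show ?thesis using mlin_image_scale[OF _ \<open>m \<ge> 1\<close>] by metis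
  next
    case False
    then have "?M$1$1 * flip ?M$2$2 \<noteq> flip ?M$1$1 * ?M$2$2" using pq p q by simp
    from mlin_eval_parity_plane[OF x linear_functional_nth linear_functional_nth this, of s s]
    obtain z where "mlin_eval m c z $1$1 = s" "mlin_eval m c z $2$2 = s"
      "homogeneous (1::2) 0 (mlin_eval m c z)" by (metis deg of_int_0)
    then have "mlin_eval m c z = mat s" by (auto simp: homogeneous_def mat2_eq_iff mat_nth)
    then show ?thesis by (auto simp: mlin_image_def) metis
  qed
qed

text \<open>The integer grading separates e12 from e21, so a homogeneous value with nonzero (1,2)
  entry is a multiple of e12; with its flip it spans the off-diagonal plane.\<close>

lemma off_diagonal_mem_mlin_image:
  assumes "mlin_eval m c a $1$2 \<noteq> 0 \<or> mlin_eval m c a $2$1 \<noteq> 0"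
  shows "mat2 0 \<alpha> \<beta> 0 \<in> mlin_image m c"
proof -
  obtain a where "mlin_eval m c a $1$2 \<noteq> 0"
    using assms mlin_eval_flip[of m c a] by (metis flip_nth(2))
  from homogeneous_tuple_exists[OF linear_functional_nth this]
  obtain d :: "nat \<Rightarrow> int" and x where x: "\<And>i. homogeneous 1 (d i) (x i)"
    and ne: "mlin_eval m c x $1$2 \<noteq> 0" by metis
  let ?M = "mlin_eval m c x"
  have hom: "homogeneous 1 (\<Sum>i<m. d i) ?M" by (intro homogeneous_mlin_eval x)
  with ne have deg: "(\<Sum>i<m. d i) = 1" by (auto simp: homogeneous_def)
  with hom have "?M$2$1 = 0" by (auto simp: homogeneous_def)
  with ne have "?M$1$2 * flip ?M$2$1 \<noteq> flip ?M$1$2 * ?M$2$1" by simp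
  from mlin_eval_parity_plane[OF x linear_functional_nth linear_functional_nth this, of \<alpha> \<beta>]
  obtain z where "mlin_eval m c z $1$2 = \<alpha>" "mlin_eval m c z $2$1 = \<beta>"
    "homogeneous (1::2) 1 (mlin_eval m c z)" by (metis deg of_int_1)
  then have "mlin_eval m c z = mat2 0 \<alpha> \<beta> 0" by (auto simp: homogeneous_def mat2_eq_iff)
  then show ?thesis by (auto simp: mlin_image_def) metis
qed

text \<open>The companion matrix of a trace-zero matrix is off-diagonal.\<close>

lemma nonscalar_sl2_mem_mlin_image:
  assumes "\<And>\<alpha> \<beta>. mat2 0 \<alpha> \<beta> 0 \<in> mlin_image m c" "A \<in> sl2" "A \<notin> scalar_mats"
  shows "A \<in> mlin_image m c"
  using assms nonscalar_mem_mlin_image_iff[OF assms(3), of m c] by (simp add: sl2_def trace_2)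

theorem mlin_image_trichotomy:
  fixes c :: "(nat \<Rightarrow> nat) \<Rightarrow> 'a::field"
  assumes "m \<ge> 1"
  shows "mlin_image m c = {0} \<or> mlin_image m c = scalar_mats \<or> sl2 \<subseteq> mlin_image m c"
proof (cases "\<exists>a. mlin_eval m c a $1$2 \<noteq> 0 \<or> mlin_eval m c a $2$1 \<noteq> 0")
  case True
  then have off: "mat2 0 \<alpha> \<beta> 0 \<in> mlin_image m c" for \<alpha> \<beta>
    using off_diagonal_mem_mlin_image by blast
  note nonscalar = nonscalar_sl2_mem_mlin_image[OF off]
  have "A \<in> mlin_image m c" if A: "A \<in> sl2" for A
  proof (cases "A \<in> scalar_mats")
    case False
    with A nonscalar show ?thesis by blast
  next
    case scalar: True
    then obtain s where s: "A = mat s" by (auto simp: scalar_mats_def)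
    show ?thesis
    proof (cases "s = 0")
      case True
      then have "A = mat2 0 0 0 0" using s by (simp add: mat2_simps)
      then show ?thesis using off by simp
    next
      \<comment> \<open>Only in characteristic 2 does sl2 contain nonzero scalar matrices.\<close>
      case False
      have "s + s = 0" using A s by (simp add: sl2_def mat2_simps)
      then have "(1 + 1) * s = 0" by (simp only: distrib_right mult_1_left)
      with False have two: "(1::'a) + 1 = 0" by simp
      \<comment> \<open>A nonscalar matrix of trace 0 with nonzero (1,1) entry, which leads to a
        homogeneous value of degree 0.\<close>
      have "mat2 (-1) 1 (-1) 1 \<in> mlin_image m c"
        by (rule nonscalar) (auto simp: sl2_def scalar_mats_def mat2_simps)
      then obtain a where "mlin_eval m c a $1$1 \<noteq> 0"
        by (auto simp: mlin_image_def) (metis mat2_nth(1) neg_equal_0_iff_equal one_neq_zero)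
      from homogeneous_tuple_exists[OF linear_functional_nth this]
      obtain d :: "nat \<Rightarrow> int" and x where x: "\<And>i. homogeneous 1 (d i) (x i)"
        and ne: "mlin_eval m c x $1$1 \<noteq> 0" by metis
      \<comment> \<open>In characteristic 2, p^2 - q^2 = (p - q)^2.\<close>
      have "p = q \<or> p * p \<noteq> q * q" for p q :: 'a
      proof -
        have "(p - q) * (p - q) = p * p - q * q - (1 + 1) * (p - q) * q"
          by (simp add: algebra_simps)
        with two show ?thesis by auto
      qed
      then show ?thesis
        unfolding s by (intro scalar_mem_mlin_image[OF x assms refl refl]) (use ne in auto)
    qed
  qed
  then show ?thesis by blast
next
  case False
  have scalar: "M = mat (M$1$1)" if M: "M \<in> mlin_image m c" for M
  proof -
    have off: "N$1$2 = 0 \<and> N$2$1 = 0" if "N \<in> mlin_image m c" for N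
      using False that by (auto simp: mlin_image_def)
    \<comment> \<open>For diagonal \<open>M\<close> this conjugate has (1,2) entry
      \<open>M$2$2 - M$1$1\<close>, which must vanish too.\<close>
    have "mat2 1 1 0 1 ** M ** mat2 1 (-1) 0 1 \<in> mlin_image m c"
      using M by (rule mlin_image_conjugate) (simp_all add: mat2_simps)
    from off[OF this] off[OF M] show ?thesis by (simp add: mat2_simps)
  qed
  show ?thesis
  proof (cases "mlin_image m c \<subseteq> {0}")
    case True
    moreover have "mlin_image m c \<noteq> {}" by (auto simp: mlin_image_def)
    ultimately show ?thesis by blast
  next
    case False
    then obtain M where M: "M \<in> mlin_image m c" "M \<noteq> 0" by blast
    then obtain t where t: "M = mat t" using scalar by blast
    with M have "t \<noteq> 0" by (auto simp: mat2_simps)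
    have "mat s \<in> mlin_image m c" for s
    proof -
      have "mat s = mat (s / t) ** M" using \<open>t \<noteq> 0\<close> by (simp add: t mat2_simps)
      then show ?thesis using mlin_image_scale[OF M(1) assms] by simp
    qed
    then show ?thesis using scalar by (auto simp: scalar_mats_def)
  qed
qed


subsection \<open>Real matrices\<close>

text \<open>A real polynomial that is nonzero somewhere is nonzero arbitrarily close to any point, so
  tuples can be moved into general position along a line.\<close>

definition polynomial_fun :: "(real \<Rightarrow> real) \<Rightarrow> bool" where
  "polynomial_fun f \<longleftrightarrow> (\<exists>q. \<forall>x. f x = poly q x)"

lemma polynomial_fun_const: "polynomial_fun (\<lambda>_. k)"
  unfolding polynomial_fun_def by (rule exI[of _ "[:k:]"]) simp

lemma polynomial_fun_ident: "polynomial_fun (\<lambda>x. x)"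
  unfolding polynomial_fun_def by (rule exI[of _ "[:0, 1:]"]) simp

lemma polynomial_fun_add:
  "polynomial_fun f \<Longrightarrow> polynomial_fun g \<Longrightarrow> polynomial_fun (\<lambda>x. f x + g x)"
  unfolding polynomial_fun_def by (metis poly_add)

lemma polynomial_fun_mult:
  "polynomial_fun f \<Longrightarrow> polynomial_fun g \<Longrightarrow> polynomial_fun (\<lambda>x. f x * g x)"
  unfolding polynomial_fun_def by (metis poly_mult)

lemma polynomial_fun_diff:
  "polynomial_fun f \<Longrightarrow> polynomial_fun g \<Longrightarrow> polynomial_fun (\<lambda>x. f x - g x)"
  unfolding polynomial_fun_def by (metis poly_diff)

lemmas polynomial_fun_intros = polynomial_fun_const polynomial_fun_ident polynomial_fun_add
  polynomial_fun_mult polynomial_fun_diff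

lemma polynomial_fun_sum:
  "(\<And>i. i \<in> S \<Longrightarrow> polynomial_fun (f i)) \<Longrightarrow> polynomial_fun (\<lambda>x. \<Sum>i\<in>S. f i x)"
  by (induction S rule: infinite_finite_induct) (auto intro: polynomial_fun_intros)

lemma polynomial_fun_finite_zeros:
  assumes "polynomial_fun f" "f x \<noteq> 0"
  shows "finite {x. f x = 0}"
proof -
  obtain q where q: "\<And>x. f x = poly q x" using assms(1) by (auto simp: polynomial_fun_def)
  with assms(2) have "q \<noteq> 0" by auto
  then show ?thesis using poly_roots_finite[of q] q by simp
qed

lemma polynomial_fun_isCont: "polynomial_fun f \<Longrightarrow> isCont f x"
proof -
  assume "polynomial_fun f"
  then obtain q where "f = poly q" by (auto simp: polynomial_fun_def)
  then show ?thesis by simp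
qed

text \<open>The inequality at 0 persists nearby by continuity; each \<open>g i\<close>, being
  nonzero at 1, has only finitely many zeros to avoid.\<close>

lemma polynomial_fun_generic_point:
  assumes "polynomial_fun f" "f 0 > 0"
    and "finite I" "\<And>i. i \<in> I \<Longrightarrow> polynomial_fun (g i)" "\<And>i. i \<in> I \<Longrightarrow> g i 1 \<noteq> 0"
  obtains e where "f e > 0" "\<And>i. i \<in> I \<Longrightarrow> g i e \<noteq> 0"
proof -
  have "eventually (\<lambda>e. f e > 0) (at 0)"
    using polynomial_fun_isCont[OF assms(1)] assms(2) by (auto simp: isCont_def order_tendsto_iff)
  then obtain \<delta> where \<delta>: "\<delta> > 0" "\<And>e. e \<noteq> 0 \<Longrightarrow> dist e 0 < \<delta> \<Longrightarrow> f e > 0"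
    unfolding eventually_at by blast
  have "finite (\<Union>i\<in>I. {e. g i e = 0})"
    using assms polynomial_fun_finite_zeros by blast
  moreover have "infinite {0<..<\<delta>}" using \<delta>(1) by (rule infinite_Ioo)
  ultimately obtain e where "e \<in> {0<..<\<delta>}" "e \<notin> (\<Union>i\<in>I. {e. g i e = 0})"
    by (meson finite_subset subsetI)
  then show thesis using that \<delta>(2)[of e] by auto
qed

lemma polynomial_fun_mlin_eval:
  assumes "\<And>i j k. polynomial_fun (\<lambda>e. a e i $ j $ k)"
  shows "polynomial_fun (\<lambda>e. mlin_eval m r (a e) $ j $ k)"
proof -
  have "polynomial_fun (\<lambda>e. mprod (map (\<lambda>i. a e (\<sigma> i)) is) $ j $ k)" for \<sigma> "is" j k
  proof (induction "is" arbitrary: j k)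
    case Nil
    then show ?case by (simp add: polynomial_fun_const)
  next
    case (Cons i "is")
    then show ?case by (simp add: mult_nth2 polynomial_fun_intros assms)
  qed
  then show ?thesis
    unfolding mlin_eval_def sum_component scale_nth
    by (intro polynomial_fun_sum polynomial_fun_intros)
qed

section \<open>Discriminant and trace along segments of tuples\<close>

definition disc :: "real^2^2 \<Rightarrow> real" where
  "disc A = (A$1$1 - A$2$2)^2 + 4 * A$1$2 * A$2$1"

text \<open>This is the discriminant of the characteristic polynomial; with the trace it fixes the
  determinant.\<close>

lemma disc_eq: "disc A = (trace A)^2 + 4 * (A$1$2 * A$2$1 - A$1$1 * A$2$2)"
  by (simp add: disc_def trace_2 power2_eq_square algebra_simps)

lemma disc_scale: "disc (mat s ** A) = s^2 * disc A"
  by (simp add: disc_def scale_nth power2_eq_square algebra_simps)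

lemma trace_scale: "trace (mat s ** A) = s * trace (A :: real^2^2)"
  by (simp add: trace_2 scale_nth algebra_simps)

abbreviation segment :: "(nat \<Rightarrow> real^2^2) \<Rightarrow> (nat \<Rightarrow> real^2^2) \<Rightarrow> real \<Rightarrow> nat \<Rightarrow> real^2^2" where
  "segment a b e i \<equiv> mat (1 - e) ** a i + mat e ** b i"

text \<open>\<open>Q\<close> selects the coordinates that move; the others stay at
  \<open>b\<close>.\<close>

lemma polynomial_fun_segment:
  shows "polynomial_fun (\<lambda>e. disc (mlin_eval m r (\<lambda>i. if Q i then segment a b e i else b i)) -
      d * (trace (mlin_eval m r (\<lambda>i. if Q i then segment a b e i else b i)))^2)"
    and "polynomial_fun (\<lambda>e. trace (mlin_eval m r (\<lambda>i. if Q i then segment a b e i else b i)))"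
proof -
  have "polynomial_fun (\<lambda>e. (if Q i then segment a b e i else b i) $ j $ k)" for i j k
    by (cases "Q i") (auto simp: scale_nth intro!: polynomial_fun_intros)
  note [intro] = polynomial_fun_mlin_eval[OF this]
  show "polynomial_fun (\<lambda>e. disc (mlin_eval m r (\<lambda>i. if Q i then segment a b e i else b i)) -
      d * (trace (mlin_eval m r (\<lambda>i. if Q i then segment a b e i else b i)))^2)"
    unfolding disc_def trace_2 power2_eq_square by (intro polynomial_fun_intros) auto
  show "polynomial_fun (\<lambda>e. trace (mlin_eval m r (\<lambda>i. if Q i then segment a b e i else b i)))"
    unfolding trace_2 by (intro polynomial_fun_intros) auto
qed

text \<open>Along a segment on which the trace does not vanish, a sign change of disc - d * trace^2
  cannot happen only at a scalar matrix: there d = 0, and disc would have a double zero.\<close>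

lemma pencil_disc_zero:
  fixes A B :: "real^2^2"
  assumes "disc A - d * (trace A)^2 < 0" "disc B - d * (trace B)^2 > 0" "trace A * trace B > 0"
  obtains s M where "M = mat (1 - s) ** A + mat s ** B" "trace M \<noteq> 0" "disc M = d * (trace M)^2"
    "M \<notin> scalar_mats"
proof -
  define M where "M = (\<lambda>s. mat (1 - s) ** A + mat s ** B)"
  define f where "f = (\<lambda>s. disc (M s) - d * (trace (M s))^2)"
  have M_nth: "M s $ i $ j = (1 - s) * A$i$j + s * B$i$j" for s i j
    by (simp add: M_def scale_nth)
  have M01: "M 0 = A" "M 1 = B" by (simp_all add: mat2_eq_iff M_nth)
  have "continuous_on {0..1} f"
    unfolding f_def disc_def trace_2 M_nth by (intro continuous_intros)
  moreover have "f 0 < 0" "f 1 > 0" using assms M01 by (simp_all add: f_def)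
  ultimately obtain s where s: "0 \<le> s" "s \<le> 1" "f s = 0"
    using IVT'[of f 0 0 1] by auto
  have tr: "trace (M s) = (1 - s) * trace A + s * trace B"
    by (simp add: trace_2 M_nth algebra_simps)
  \<comment> \<open>Since the end traces have the same sign, the trace is nonzero along the
    segment.\<close>
  have "trace (M s) * trace A = (1 - s) * (trace A * trace A) + s * (trace A * trace B)"
    by (simp add: tr algebra_simps)
  moreover have "trace A * trace A > 0" using assms(3) by (auto simp: zero_less_mult_iff)
  moreover have "s > 0" using s \<open>f 0 < 0\<close> by (cases "s = 0") auto
  ultimately have "trace (M s) * trace A > 0"
    using s assms(3) by (simp add: add_nonneg_pos)
  then have tr0: "trace (M s) \<noteq> 0" by auto
  have "M s \<notin> scalar_mats"
  proof
    assume "M s \<in> scalar_mats"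
    then obtain \<mu> where "M s = mat \<mu>" by (auto simp: scalar_mats_def)
    then have sc: "M s $1$1 = M s $2$2" "M s $1$2 = 0" "M s $2$1 = 0" by (simp_all add: mat_nth)
    then have "d * (trace (M s))^2 = 0" using s(3) by (simp add: f_def disc_def)
    then have "d = 0" using tr0 by simp
    \<comment> \<open>The traceless parts of s B and (1 - s) A are opposite, so their discriminants
      agree, against the signs at the two ends.\<close>
    have "s * (B$1$1 - B$2$2) = - ((1 - s) * (A$1$1 - A$2$2))"
      "s * B$1$2 = - ((1 - s) * A$1$2)" "s * B$2$1 = - ((1 - s) * A$2$1)"
      using sc unfolding M_nth by (simp_all add: algebra_simps)
    then have "(s * (B$1$1 - B$2$2))^2 + 4 * (s * B$1$2) * (s * B$2$1) =
        ((1 - s) * (A$1$1 - A$2$2))^2 + 4 * ((1 - s) * A$1$2) * ((1 - s) * A$2$1)"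
      by simp
    then have "s^2 * disc B = (1 - s)^2 * disc A"
      by (simp add: disc_def power2_eq_square algebra_simps)
    moreover have "s^2 * disc B > 0" using assms(2) \<open>d = 0\<close> \<open>s > 0\<close> by simp
    moreover have "(1 - s)^2 * disc A \<le> 0"
      using assms(1) \<open>d = 0\<close> by (simp add: mult_nonneg_nonpos)
    ultimately show False by linarith
  qed
  then show thesis using that[of "M s" s] tr0 s(3) by (simp add: M_def f_def)
qed

text \<open>At \<open>a\<close> the trace term vanishes, so the sign is that of \<open>disc\<close>
  for every \<open>d\<close>; a small generic move towards \<open>b\<close> keeps it and makes the
  trace nonzero.\<close>

lemma exists_nonzero_trace_disc_sign:
  fixes \<epsilon> :: real
  assumes b: "trace (mlin_eval m r b) \<noteq> 0"
    and a: "trace (mlin_eval m r a) = 0" "\<epsilon> * disc (mlin_eval m r a) > 0"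
  obtains x where "trace (mlin_eval m r x) \<noteq> 0"
    "\<epsilon> * (disc (mlin_eval m r x) - d * (trace (mlin_eval m r x))^2) > 0"
proof -
  let ?P = "\<lambda>e. mlin_eval m r (segment a b e)"
  have P01: "?P 0 = mlin_eval m r a" "?P 1 = mlin_eval m r b"
    by (intro mlin_eval_cong; simp add: mat2_eq_iff scale_nth)+
  note pf = polynomial_fun_segment[where m = m and r = r and Q = "\<lambda>_. True" and a = a and b = b, simplified]
  obtain e where "\<epsilon> * (disc (?P e) - d * (trace (?P e))^2) > 0" "\<And>i. i \<in> {()} \<Longrightarrow> trace (?P e) \<noteq> 0"
    by (rule polynomial_fun_generic_point[of "\<lambda>e. \<epsilon> * (disc (?P e) - d * (trace (?P e))^2)" "{()}"
          "\<lambda>_ e. trace (?P e)"])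
      (use a b P01 in \<open>auto intro!: polynomial_fun_intros(1,4) pf\<close>)
  then show thesis using that by blast
qed

text \<open>Passing from \<open>x\<close> to a perturbation of \<open>y\<close> one coordinate at a
  time, the sign changes on some edge, where the value is affine and \<open>pencil_disc_zero\<close>
  applies.\<close>

lemma exists_nonscalar_disc:
  assumes x: "trace (mlin_eval m r x) \<noteq> 0"
      "disc (mlin_eval m r x) - d * (trace (mlin_eval m r x))^2 < 0"
    and y: "trace (mlin_eval m r y) \<noteq> 0"
      "disc (mlin_eval m r y) - d * (trace (mlin_eval m r y))^2 > 0"
  obtains M where "M \<in> mlin_image m r" "trace M \<noteq> 0" "disc M = d * (trace M)^2" "M \<notin> scalar_mats"
proof -
  let ?P = "mlin_eval m r"
  let ?Q = "\<lambda>M. disc M - d * (trace M)^2"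
  \<comment> \<open>The k-th vertex of the polygon. At \<open>e = 1\<close> every vertex is
    \<open>x\<close>, so no polynomial to be avoided is identically zero.\<close>
  let ?mix = "\<lambda>e k i. if i < k then segment y x e i else x i"
  have mix1: "?P (?mix 1 k) = ?P x" for k
    by (intro mlin_eval_cong) (simp add: mat2_eq_iff scale_nth)
  have mix0: "?P (?mix 0 m) = ?P y"
    by (intro mlin_eval_cong) (simp add: mat2_eq_iff scale_nth)
  \<comment> \<open>For generic e all vertices of the polygon from x to the perturbed point avoid trace 0 and
    the zero set of the quadratic form.\<close>
  obtain e where e: "?Q (?P (?mix e m)) > 0"
    "\<And>k. k \<in> {..m} \<Longrightarrow> trace (?P (?mix e k)) * ?Q (?P (?mix e k)) \<noteq> 0"
    by (rule polynomial_fun_generic_point[of "\<lambda>e. ?Q (?P (?mix e m))" "{..m}"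
          "\<lambda>k e. trace (?P (?mix e k)) * ?Q (?P (?mix e k))"])
      (use x y mix1 mix0 in
        \<open>auto intro!: polynomial_fun_intros(4) polynomial_fun_segment\<close>)
  define z where "z = ?mix e"
  have z0: "z 0 = x" by (simp add: z_def)
  have "\<exists>k<m. ?Q (?P (z k)) < 0 \<and> ?Q (?P (z (Suc k))) > 0"
  proof (rule ccontr)
    assume *: "\<not> ?thesis"
    have "?Q (?P (z k)) < 0" if "k \<le> m" for k
      using that
    proof (induction k)
      case 0
      then show ?case using x z0 by simp
    next
      case (Suc k)
      then have "\<not> ?Q (?P (z (Suc k))) > 0" using * by auto
      moreover have "?Q (?P (z (Suc k))) \<noteq> 0" using e(2)[of "Suc k"] Suc.prems by (auto simp: z_def)
      ultimately show ?case by linarith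
    qed
    from this[of m] e(1) show False by (simp add: z_def)
  qed
  then obtain k where k: "k < m" "?Q (?P (z k)) < 0" "?Q (?P (z (Suc k))) > 0" by blast
  define A where "A = ?P (z k)"
  \<comment> \<open>The sign \<open>\<eta>\<close> makes the end traces agree in sign without
    changing the quadratic form.\<close>
  define \<eta> where "\<eta> = sgn (trace A * trace (?P (z (Suc k))))"
  define B where "B = mat \<eta> ** ?P (z (Suc k))"
  have tr: "trace A \<noteq> 0" "trace (?P (z (Suc k))) \<noteq> 0"
    using e(2)[of k] e(2)[of "Suc k"] k(1) by (auto simp: A_def z_def)
  then have \<eta>: "\<eta>^2 = 1" "trace A * trace B > 0"
    by (auto simp: \<eta>_def B_def trace_scale sgn_if power2_eq_square zero_less_mult_iff mult_less_0_iff)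
  have "?Q A < 0" "?Q B > 0"
    using k \<eta>(1) by (simp_all add: A_def B_def disc_scale trace_scale power_mult_distrib)
  from pencil_disc_zero[OF this \<eta>(2)]
  obtain s M where M: "M = mat (1 - s) ** A + mat s ** B" "trace M \<noteq> 0"
    "disc M = d * (trace M)^2" "M \<notin> scalar_mats" .
  \<comment> \<open>Consecutive vertices differ only in coordinate \<open>k\<close>, which also
    absorbs \<open>\<eta>\<close>.\<close>
  have "z (Suc k) = (z k)(k := z (Suc k) k)" by (auto simp: z_def less_Suc_eq)
  then have "?P ((z k)(k := mat (1 - s) ** z k k + mat (s * \<eta>) ** z (Suc k) k)) = M"
    using mlin_eval_linear[OF k(1), of r "z k" "1 - s" "z k k" "s * \<eta>" "z (Suc k) k"]
    by (simp add: M(1) A_def B_def mat2_eq_iff scale_nth)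
  then have "M \<in> mlin_image m r" by (auto simp: mlin_image_def)
  then show thesis using that M by blast
qed

theorem real_mlin_image_UNIV:
  fixes r :: "(nat \<Rightarrow> nat) \<Rightarrow> real"
  assumes "m \<ge> 1" and sl2: "sl2 \<subseteq> mlin_image m r" and ne: "mlin_image m r \<noteq> sl2"
  shows "mlin_image m r = UNIV"
proof -
  obtain b where b: "trace (mlin_eval m r b) \<noteq> 0"
    using sl2 ne by (auto simp: sl2_def mlin_image_def)
  have scalar: "mat s \<in> mlin_image m r" for s
  proof -
    obtain d :: "nat \<Rightarrow> int" and x where x: "\<And>i. homogeneous 1 (d i) (x i)"
      "trace (mlin_eval m r x) \<noteq> 0"
      using homogeneous_tuple_exists[OF linear_functional_trace b] by metis
    \<comment> \<open>Nonzero trace rules out q = -p.\<close>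
    have "p = q \<or> p * p \<noteq> q * q" if "p + q \<noteq> 0" for p q :: real
      using that square_eq_iff[of p q] by auto
    then show ?thesis
      by (intro scalar_mem_mlin_image[of d x, OF x(1) assms(1) refl refl]) (use x(2) in \<open>auto simp: trace_2\<close>)
  qed
  have "A \<in> mlin_image m r" if nonscalar: "A \<notin> scalar_mats" and tr: "trace A \<noteq> 0" for A
  proof -
    define d where "d = disc A / (trace A)^2"
    \<comment> \<open>Two trace-zero values with discriminants -4 and 4.\<close>
    have "mat2 0 (-1) 1 0 \<in> mlin_image m r" "mat2 0 1 1 0 \<in> mlin_image m r"
      using sl2 by (auto simp: sl2_def trace_2)
    then obtain u v where uv: "mlin_eval m r u = mat2 0 (-1) 1 0" "mlin_eval m r v = mat2 0 1 1 0"
      by (auto simp: mlin_image_def)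
    obtain x where x: "trace (mlin_eval m r x) \<noteq> 0"
      "-1 * (disc (mlin_eval m r x) - d * (trace (mlin_eval m r x))^2) > 0"
      by (rule exists_nonzero_trace_disc_sign[OF b, of u "-1" d]) (auto simp: uv disc_def trace_2)
    obtain y where y: "trace (mlin_eval m r y) \<noteq> 0"
      "1 * (disc (mlin_eval m r y) - d * (trace (mlin_eval m r y))^2) > 0"
      by (rule exists_nonzero_trace_disc_sign[OF b, of v 1 d]) (auto simp: uv disc_def trace_2)
    obtain M where M: "M \<in> mlin_image m r" "trace M \<noteq> 0" "disc M = d * (trace M)^2" "M \<notin> scalar_mats"
      by (rule exists_nonscalar_disc[of m r x d y]) (use x y in auto)
    \<comment> \<open>Rescaling \<open>M\<close> to the trace of \<open>A\<close> also matches the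
      discriminant, hence the determinant and the companion matrix.\<close>
    define t where "t = trace A / trace M"
    define N where "N = mat t ** M"
    have "t \<noteq> 0" using tr M by (simp add: t_def)
    have N: "N \<in> mlin_image m r" unfolding N_def using M(1) assms(1) by (rule mlin_image_scale)
    have trN: "trace N = trace A" using M(2) by (simp add: N_def trace_scale t_def)
    have "disc N = d * (trace N)^2" by (simp add: N_def trace_scale disc_scale M(3) power_mult_distrib)
    then have "disc N = disc A" using tr by (simp add: trN d_def)
    then have "N$1$2 * N$2$1 - N$1$1 * N$2$2 = A$1$2 * A$2$1 - A$1$1 * A$2$2"
      by (simp add: disc_eq trN)
    moreover have "N \<notin> scalar_mats"
    proof
      assume "N \<in> scalar_mats"
      then obtain \<mu> where "N = mat \<mu>" by (auto simp: scalar_mats_def)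
      then have "M = mat (\<mu> / t)"
        using \<open>t \<noteq> 0\<close> by (simp add: N_def mat2_eq_iff scale_nth mat_nth field_simps)
      then show False using M(4) by (auto simp: scalar_mats_def)
    qed
    ultimately show ?thesis
      using nonscalar_mem_mlin_image_iff[OF nonscalar, of m r]
        nonscalar_mem_mlin_image_iff[of N m r] N trN by (simp add: trace_2)
  qed
  then show ?thesis using scalar sl2 by (force simp: scalar_mats_def sl2_def)
qed

theorem theorem1p8:
  fixes m :: nat
    and c :: "(nat \<Rightarrow> nat) \<Rightarrow> 'a::field"
    and r :: "(nat \<Rightarrow> nat) \<Rightarrow> real"
  assumes "m \<ge> 1"
  shows "(mlin_image m c = {0} \<or> mlin_image m c = scalar_mats \<or> sl2 \<subseteq> mlin_image m c)
       \<and> (mlin_image m r = {0} \<or> mlin_image m r = scalar_mats \<or> mlin_image m r = sl2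
         \<or> mlin_image m r = UNIV)"
proof (rule conjI)
  show "mlin_image m c = {0} \<or> mlin_image m c = scalar_mats \<or> sl2 \<subseteq> mlin_image m c"
    by (rule mlin_image_trichotomy[OF assms])
  show "mlin_image m r = {0} \<or> mlin_image m r = scalar_mats \<or> mlin_image m r = sl2
      \<or> mlin_image m r = UNIV"
    using mlin_image_trichotomy[OF assms, of r] real_mlin_image_UNIV[OF assms, of r] by argo
qed

end
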